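(* Let $G$ be a finite simple graph containing an odd cycle $C_{2n+1}=(x_1,\ldots,x_{2n+1})$ as an induced subgraph. A maximum matching $M$ in $C_{2n+1}$ has $n$ edges, which saturate $2n$ vertices of $C_{2n+1}$, and only one vertex of $C_{2n+1}$ remains unsaturated; a Type-II edge cover for $C_{2n+1}$ in $G$ of size $n+1$ can be constructed by adding to $M$ one edge from $E(G)\setminus E(C_{2n+1})$ at the unsaturated vertex. The Type-II edge cover number for $C_{2n+1}$ in $G$ is $\gamma''(C_{2n+1})=n+1$. Any Type-II edge cover for $C_{2n+1}$ in $G$ that does not contain any maximum matching of $C_{2n+1}$ has more than $n+1$ edges. Hence every Type-II minimum edge cover for $C_{2n+1}$ in $G$ consists of the edges of a maximum matching $M$ in $C_{2n+1}$ and one edge from $E(G)\setminus E(C_{2n+1})$ connected with the vertex of $C_{2n+1}$ not saturated by the edges of $M$.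
   Context: Let $H$ be an induced subgraph of a finite simple graph $G$. An edge cover for $H$ in $G$ is a set $L\subseteq E(G)$ such that every vertex of $H$ is incident to some edge of $L$. It is a Type-II edge cover for $H$ in $G$ if some edge of $L$ lies in $E(G)\setminus E(H)$. A Type-II edge cover for $H$ in $G$ is minimal if no proper subset of it is a Type-II edge cover for $H$ in $G$. A Type-II minimum edge cover for $H$ in $G$ is a Type-II minimal edge cover for $H$ in $G$ of the smallest possible size, and this size is the Type-II edge cover number $\gamma''(H)$. A matching is a set of pairwise disjoint edges; a maximum matching is a matching of largest size; a vertex is saturated by a matching $M$ if it lies in some edge of $M$, and unsaturated otherwise.
   Formalization: The value n+1 of the Type-II edge cover number and the form of minimum covers assume that some edge of E(G)∖E(C) meets a vertex of the cycle (false for a triangle plus a disjoint edge); extending a given M assumes such an edge at its unsaturated vertex. *)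

theory Defs
  imports Main
begin

datatype 'a graph = Graph (verts: "'a set") (edges: "'a set set")

definition finite_simple_graph :: "'a graph \<Rightarrow> bool" where
  "finite_simple_graph G \<longleftrightarrow>
     finite (verts G) \<and> (\<forall>e\<in>edges G. e \<subseteq> verts G \<and> card e = 2)"

definition induced_subgraph :: "'a graph \<Rightarrow> 'a graph \<Rightarrow> bool" where
  "induced_subgraph H G \<longleftrightarrow>
     verts H \<subseteq> verts G \<and> edges H = {e \<in> edges G. e \<subseteq> verts H}"

text \<open>The cycle through the vertices of \<open>xs\<close> in this order. It is a cycle of a simple
  graph only if \<open>xs\<close> is distinct and has length at least 3.\<close>

definition cycle_graph :: "'a list \<Rightarrow> 'a graph" where
  "cycle_graph xs =
     Graph (set xs) {{xs ! i, xs ! (Suc i mod length xs)} | i. i < length xs}"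

definition edge_cover :: "'a graph \<Rightarrow> 'a graph \<Rightarrow> 'a set set \<Rightarrow> bool" where
  "edge_cover G H L \<longleftrightarrow> L \<subseteq> edges G \<and> (\<forall>v\<in>verts H. \<exists>e\<in>L. v \<in> e)"

definition typeII_edge_cover :: "'a graph \<Rightarrow> 'a graph \<Rightarrow> 'a set set \<Rightarrow> bool" where
  "typeII_edge_cover G H L \<longleftrightarrow>
     edge_cover G H L \<and> (\<exists>e\<in>L. e \<in> edges G - edges H)"

definition typeII_minimal_edge_cover :: "'a graph \<Rightarrow> 'a graph \<Rightarrow> 'a set set \<Rightarrow> bool" where
  "typeII_minimal_edge_cover G H L \<longleftrightarrow>
     typeII_edge_cover G H L \<and> (\<forall>L'. L' \<subset> L \<longrightarrow> \<not> typeII_edge_cover G H L')"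

definition typeII_minimum_edge_cover :: "'a graph \<Rightarrow> 'a graph \<Rightarrow> 'a set set \<Rightarrow> bool" where
  "typeII_minimum_edge_cover G H L \<longleftrightarrow>
     typeII_minimal_edge_cover G H L \<and>
     (\<forall>L'. typeII_minimal_edge_cover G H L' \<longrightarrow> card L \<le> card L')"

text \<open>Meaningful only if some Type-II edge cover for \<open>H\<close> in \<open>G\<close> exists; otherwise
  the value is unspecified.\<close>

definition typeII_edge_cover_number :: "'a graph \<Rightarrow> 'a graph \<Rightarrow> nat" where
  "typeII_edge_cover_number G H =
     (LEAST k. \<exists>L. typeII_minimal_edge_cover G H L \<and> card L = k)"

definition matching :: "'a graph \<Rightarrow> 'a set set \<Rightarrow> bool" where
  "matching H M \<longleftrightarrow> M \<subseteq> edges H \<and> pairwise disjnt M"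

definition maximum_matching :: "'a graph \<Rightarrow> 'a set set \<Rightarrow> bool" where
  "maximum_matching H M \<longleftrightarrow>
     matching H M \<and> (\<forall>M'. matching H M' \<longrightarrow> card M' \<le> card M)"

definition saturated :: "'a set set \<Rightarrow> 'a \<Rightarrow> bool" where
  "saturated M v \<longleftrightarrow> (\<exists>e\<in>M. v \<in> e)"

end

(* Every edge meets the 2n+1 cycle vertices at most twice, and an edge outside the induced cycle
   meets them at most once. Hence n+1 edges, one of them outside the cycle, can cover the cycle
   only if they meet its vertices exactly 2n+1 times without overlap: the other n edges then
   form a matching of the cycle. *)
theory Submission
  imports Defs
begin

section \<open>Counting vertices and edges in finite simple graphs\<close>

lemma finite_simple_graph_finite_edges:
  assumes "finite_simple_graph G"
  shows "finite (edges G)"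
proof -
  have "edges G \<subseteq> Pow (verts G)" "finite (verts G)"
    using assms by (auto simp: finite_simple_graph_def)
  then show ?thesis
    by (meson finite_Pow_iff finite_subset)
qed

lemma induced_subgraph_simple:
  assumes "finite_simple_graph G" and "induced_subgraph H G"
  shows "finite_simple_graph H"
  using assms finite_subset[of "verts H" "verts G"]
  by (auto simp: finite_simple_graph_def induced_subgraph_def)

lemma card_Union_edges_le:
  assumes "finite_simple_graph G" and "K \<subseteq> edges G"
  shows "card (\<Union>K) \<le> 2 * card K"
proof -
  have "finite K"
    using assms finite_simple_graph_finite_edges finite_subset by blast
  have "card (\<Union>K) \<le> (\<Sum>e\<in>K. card e)"
    by (rule card_Union_le_sum_card)
  also have "\<dots> = (\<Sum>e\<in>K. 2)"
    using assms by (intro sum.cong) (auto simp: finite_simple_graph_def)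
  finally show ?thesis
    by (simp add: mult.commute)
qed

section \<open>Matchings in a graph of odd order\<close>

lemma card_saturated_matching:
  assumes "finite_simple_graph H" and "matching H M"
  shows "card {v \<in> verts H. saturated M v} = 2 * card M"
proof -
  have sub: "M \<subseteq> edges H" and dis: "pairwise disjnt M"
    using assms by (auto simp: matching_def)
  have two: "e \<subseteq> verts H \<and> card e = 2" if "e \<in> M" for e
    using that sub assms(1) by (auto simp: finite_simple_graph_def)
  have "{v \<in> verts H. saturated M v} = \<Union>M"
    using two by (auto simp: saturated_def)
  \<comment> \<open>\<open>card\<close> is 0 on infinite sets, so cardinality 2 already makes each
    edge finite.\<close>
  moreover have "card (\<Union>M) = sum card M"
    using two by (intro card_Union_disjoint[OF dis]) (metis card.infinite zero_neq_numeral)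
  moreover have "sum card M = 2 * card M"
    using two by simp
  ultimately show ?thesis by simp
qed

lemma matching_card_le:
  assumes "finite_simple_graph H" and "matching H M"
  shows "2 * card M \<le> card (verts H)"
proof -
  have "card {v \<in> verts H. saturated M v} \<le> card (verts H)"
    using assms(1) by (intro card_mono) (auto simp: finite_simple_graph_def)
  then show ?thesis
    using card_saturated_matching[OF assms] by simp
qed

text \<open>A matching takes up two vertices per edge, so none exceeds n edges, and
  \<open>M0\<close> shows that n is attained. This trades maximality for an edge count that the
  later arguments can establish directly.\<close>

lemma maximum_matching_iff_odd:
  assumes "finite_simple_graph H" and "card (verts H) = 2 * n + 1"
    and "matching H M0" and "card M0 = n"
  shows "maximum_matching H M \<longleftrightarrow> matching H M \<and> card M = n"
proof -
  have "card M' \<le> n" if "matching H M'" for M'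
    using matching_card_le[OF assms(1) that] assms(2) by simp
  then show ?thesis
    using assms(3,4) unfolding maximum_matching_def by (metis le_antisym)
qed

lemma ex1_unsaturated:
  assumes "finite_simple_graph H" and "card (verts H) = 2 * n + 1"
    and "matching H M" and "card M = n"
  shows "\<exists>!v. v \<in> verts H \<and> \<not> saturated M v"
proof -
  have fin: "finite (verts H)"
    using assms(1) by (simp add: finite_simple_graph_def)
  have "{v \<in> verts H. \<not> saturated M v} = verts H - {v \<in> verts H. saturated M v}"
    by auto
  then have "card {v \<in> verts H. \<not> saturated M v} = 1"
    using card_saturated_matching[OF assms(1,3)] assms(2,4) fin by (simp add: card_Diff_subset)
  then obtain v where "{v \<in> verts H. \<not> saturated M v} = {v}"
    by (auto simp: card_1_singleton_iff)
  then show ?thesis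
    by (auto simp: set_eq_iff)
qed

section \<open>Type-II covers with n + 1 edges\<close>

text \<open>With n matching edges, \<open>v\<close> is the only vertex left for \<open>e\<close> to
  cover; and \<open>e\<close> is new to \<open>M\<close> because it lies outside
  \<open>H\<close>.\<close>

lemma typeII_edge_cover_insert_matching:
  assumes "finite_simple_graph G" and "induced_subgraph H G"
    and "card (verts H) = 2 * n + 1" and "matching H M" and "card M = n"
    and "v \<in> verts H" and "\<not> saturated M v" and "e \<in> edges G - edges H" and "v \<in> e"
  shows "typeII_edge_cover G H (insert e M)" and "card (insert e M) = n + 1"
proof -
  have H: "finite_simple_graph H"
    using assms(1,2) by (rule induced_subgraph_simple)
  have sub: "M \<subseteq> edges H" "edges H \<subseteq> edges G"
    using assms(2,4) by (auto simp: matching_def induced_subgraph_def)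
  have "w = v \<or> saturated M w" if "w \<in> verts H" for w
    using ex1_unsaturated[OF H assms(3-5)] assms(6,7) that by blast
  then have "\<exists>f\<in>insert e M. w \<in> f" if "w \<in> verts H" for w
    using assms(9) that by (auto simp: saturated_def)
  then show "typeII_edge_cover G H (insert e M)"
    using sub assms(8) by (auto simp: typeII_edge_cover_def edge_cover_def)
  have "finite M"
    using finite_subset[OF sub(1) finite_simple_graph_finite_edges[OF H]] .
  moreover have "e \<notin> M"
    using sub assms(8) by auto
  ultimately show "card (insert e M) = n + 1"
    using assms(5) by simp
qed

text \<open>The counting works for every induced subgraph on 2n + 1 vertices. The exact value of
  \<open>card L\<close> is part of the conclusion so that the lower bound n + 1 for all Type-II
  covers can be read off as well.\<close>

lemma small_typeII_edge_coverE:
  assumes G: "finite_simple_graph G" and ind: "induced_subgraph H G"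
    and cH: "card (verts H) = 2 * n + 1"
    and cov: "typeII_edge_cover G H L" and small: "card L \<le> n + 1"
  obtains M v e where "matching H M" and "card M = n" and "v \<in> verts H" and "\<not> saturated M v"
    and "e \<in> edges G - edges H" and "v \<in> e" and "L = insert e M" and "card L = n + 1"
proof -
  have H: "finite_simple_graph H"
    using G ind by (rule induced_subgraph_simple)
  have finV: "finite (verts H)"
    using H by (simp add: finite_simple_graph_def)
  have LG: "L \<subseteq> edges G" and VL: "verts H \<subseteq> \<Union>L"
    using cov by (auto simp: typeII_edge_cover_def edge_cover_def)
  have finL: "finite L"
    using LG finite_simple_graph_finite_edges[OF G] by (rule finite_subset)
  obtain e where e: "e \<in> L" "e \<in> edges G - edges H"
    using cov by (auto simp: typeII_edge_cover_def)
  define M where "M = L - {e}"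
  have L: "L = insert e M" and MG: "M \<subseteq> edges G" and finM: "finite M" and "e \<notin> M"
    using e LG finL by (auto simp: M_def)
  then have cL: "card L = Suc (card M)"
    by simp
  have edge: "finite a \<and> card a = 2" if "a \<in> edges G" for a
    using G that by (auto simp: finite_simple_graph_def intro: card_ge_0_finite)
  have outer: "card (a \<inter> verts H) \<le> 1" if "a \<in> edges G" "a \<notin> edges H" for a
  proof -
    \<comment> \<open>An edge of \<open>G\<close> with both ends in \<open>H\<close> would belong to
      the induced subgraph.\<close>
    have "a \<inter> verts H \<subset> a"
      using that ind by (auto simp: induced_subgraph_def)
    then have "card (a \<inter> verts H) < card a"
      using edge[OF that(1)] by (intro psubset_card_mono) auto
    then show ?thesis
      using edge[OF that(1)] by simp
  qed
  have finU: "finite (\<Union>K)" if "K \<subseteq> M" for K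
    using that MG edge finite_subset[OF that finM] by (intro finite_Union) auto
  \<comment> \<open>The edge \<open>e\<close> takes care of at most one vertex, so 2n vertices are
    left to the at most n edges of \<open>M\<close>. Any edge of \<open>M\<close> that is wasteful
    will contradict this bound.\<close>
  have rest: "2 * n \<le> card (\<Union>M \<inter> verts H)"
  proof -
    have "verts H = (e \<inter> verts H) \<union> (\<Union>M \<inter> verts H)"
      using VL L by auto
    then have "card (verts H) \<le> card (e \<inter> verts H) + card (\<Union>M \<inter> verts H)"
      by (metis card_Un_le)
    then show ?thesis
      using outer[of e] e cH by simp
  qed
  have "card (\<Union>M \<inter> verts H) \<le> card (\<Union>M)"
    using finU by (intro card_mono) auto
  then have cM: "card M = n"
    using rest card_Union_edges_le[OF G MG] cL small by linarith
  \<comment> \<open>An outer edge in \<open>M\<close> would bring the count down to 1 + 2(n - 1) <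
    2n. As the subtraction is truncated, \<open>n > 0\<close> has to be recorded.\<close>
  have MH: "a \<in> edges H" if a: "a \<in> M" for a
  proof (rule ccontr)
    assume "a \<notin> edges H"
    then have "card (a \<inter> verts H) \<le> 1"
      using outer a MG by auto
    moreover have "card (\<Union>(M - {a})) \<le> 2 * (n - 1)"
      using card_Union_edges_le[OF G, of "M - {a}"] MG a finM cM by auto
    moreover have "card (\<Union>M \<inter> verts H) \<le> card ((a \<inter> verts H) \<union> \<Union>(M - {a}))"
      using finU[of "M - {a}"] finV by (intro card_mono) auto
    moreover have "card ((a \<inter> verts H) \<union> \<Union>(M - {a})) \<le> card (a \<inter> verts H) + card (\<Union>(M - {a}))"
      by (rule card_Un_le)
    moreover have "n > 0"
      using cM a finM card_gt_0_iff by blast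
    ultimately show False
      using rest by linarith
  qed
  \<comment> \<open>Two distinct edges that meet have at most 3 vertices together, and the other n -
    2 edges at most 2(n - 2): in total 2n - 1, one too few.\<close>
  have disj: "disjnt a b" if ab: "a \<in> M" "b \<in> M" "a \<noteq> b" for a b
  proof (rule ccontr)
    assume "\<not> disjnt a b"
    have fin: "finite a" "finite b" "card a = 2" "card b = 2"
      using edge ab MG by auto
    have "card (a \<inter> b) > 0"
      using \<open>\<not> disjnt a b\<close> fin by (auto simp: disjnt_def card_gt_0_iff)
    then have "card (a \<union> b) \<le> 3"
      using card_Un_Int[of a b] fin by linarith
    moreover have "card {a, b} = 2"
      using ab by simp
    then have "card (M - {a, b}) = n - 2" "n \<ge> 2"
      using card_Diff_subset[of "{a, b}" M] card_mono[OF finM, of "{a, b}"] ab cM by auto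
    moreover have "card (\<Union>(M - {a, b})) \<le> 2 * card (M - {a, b})"
      using MG by (intro card_Union_edges_le[OF G]) auto
    moreover have "card (\<Union>M \<inter> verts H) \<le> card ((a \<union> b) \<union> \<Union>(M - {a, b}))"
      using finU[of "M - {a, b}"] fin by (intro card_mono) auto
    moreover have "card ((a \<union> b) \<union> \<Union>(M - {a, b})) \<le> card (a \<union> b) + card (\<Union>(M - {a, b}))"
      by (rule card_Un_le)
    ultimately show False
      using rest by linarith
  qed
  have M: "matching H M"
    using MH disj by (auto simp: matching_def pairwise_def)
  obtain v where v: "v \<in> verts H" "\<not> saturated M v"
    using ex1_unsaturated[OF H cH M cM] by auto
  then have "v \<in> e"
    using VL L by (auto simp: saturated_def)
  then show thesis
    using that M cM v e(2) L cL by simp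
qed

section \<open>Matchings of an odd cycle that miss a prescribed vertex\<close>

text \<open>Walking around the cycle from \<open>v\<close>, the 2n vertices after \<open>v\<close>
  are paired off consecutively. The choice of \<open>v\<close> must be free because an outer edge
  may be available at one particular vertex only.\<close>

lemma odd_cycle_near_perfect_matching:
  assumes len: "length xs = 2 * n + 1" and dist: "distinct xs" and v: "v \<in> set xs"
  obtains M where "matching (cycle_graph xs) M" and "card M = n" and "\<not> saturated M v"
proof -
  obtain j where j: "j < length xs" "v = xs ! j"
    using v by (auto simp: in_set_conv_nth)
  have lt: "i mod length xs < length xs" for i
    using j(1) by (intro mod_less_divisor) linarith
  define f where "f k = xs ! ((j + k) mod length xs)" for k
  have f0: "f 0 = v"
    using j by (simp add: f_def)
  have f_eq: "f k = f l \<longleftrightarrow> k = l" if "k < length xs" "l < length xs" for k l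
  proof
    assume "f k = f l"
    then have eq: "(j + k) mod length xs = (j + l) mod length xs"
      by (simp add: f_def nth_eq_iff_index_eq[OF dist lt lt])
    \<comment> \<open>Both summands are below \<open>length xs\<close>, so the walk wraps around at
      most once; the case split leaves linear arithmetic.\<close>
    have "(j + i) mod length xs = (if j + i < length xs then j + i else j + i - length xs)"
      if "i < length xs" for i
      using that j(1) by (simp add: le_mod_geq)
    then show "k = l"
      using that j(1) eq by (auto split: if_splits)
  qed simp
  define g where "g i = {f (2 * i + 1), f (2 * i + 2)}" for i
  have disj: "disjnt (g i) (g k)" if "i < n" "k < n" "i \<noteq> k" for i k
  proof -
    \<comment> \<open>Each pair starts at an odd position and ends at an even one, so ends of
      different kinds never coincide.\<close>
    have "2 * i + 1 \<noteq> 2 * k + 2" "2 * i + 2 \<noteq> 2 * k + 1"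
      by presburger+
    then show ?thesis
      using that len by (auto simp: g_def disjnt_def f_eq)
  qed
  \<comment> \<open>Equal pairs with different indices would be disjoint from themselves, yet no
    pair is empty.\<close>
  have "inj_on g {..<n}"
  proof (rule inj_onI, rule ccontr)
    fix i k assume "i \<in> {..<n}" "k \<in> {..<n}" "g i = g k" "i \<noteq> k"
    then show False
      using disj[of i k] by (auto simp: g_def)
  qed
  then have "card (g ` {..<n}) = n"
    by (simp add: card_image)
  moreover have "g i \<in> edges (cycle_graph xs)" for i
  proof -
    \<comment> \<open>Reducing the index first gives the shape used in \<open>cycle_graph\<close>,
      including the edge from the last list entry back to the first.\<close>
    define m where "m = (j + (2 * i + 1)) mod length xs"
    have "m < length xs"
      unfolding m_def by (rule lt)
    moreover have "g i = {xs ! m, xs ! (Suc m mod length xs)}"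
      by (simp add: g_def f_def m_def mod_Suc_eq)
    ultimately show ?thesis
      by (auto simp: cycle_graph_def)
  qed
  then have "matching (cycle_graph xs) (g ` {..<n})"
    using disj by (auto simp: matching_def pairwise_def)
  \<comment> \<open>\<open>v\<close> sits at position 0, while the pairs use the positions 1 to 2n,
    all below \<open>length xs\<close>.\<close>
  moreover have "v \<notin> g i" if "i < n" for i
    using f_eq[of 0 "2 * i + 1"] f_eq[of 0 "2 * i + 2"] that len by (auto simp: g_def f0)
  then have "\<not> saturated (g ` {..<n}) v"
    by (auto simp: saturated_def)
  ultimately show thesis
    using that by blast
qed

text \<open>The last conjunct presupposes an outer edge that meets the cycle: by
  \<open>small_typeII_edge_coverE\<close> every Type-II cover with at most n + 1 edges contains
  one.\<close>

theorem mainTheorem9: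
  fixes G C :: "'a graph" and xs :: "'a list" and n :: nat
  assumes "finite_simple_graph G"
    and "n \<ge> 1" and "length xs = 2 * n + 1" and "distinct xs"
    and "C = cycle_graph xs"
    and "induced_subgraph C G"
  shows
    "(\<forall>M. maximum_matching C M \<longrightarrow>
        card M = n \<and>
        card {v \<in> verts C. saturated M v} = 2 * n \<and>
        (\<exists>!v. v \<in> verts C \<and> \<not> saturated M v) \<and>
        (\<forall>v e. v \<in> verts C \<and> \<not> saturated M v \<and> e \<in> edges G - edges C \<and> v \<in> e \<longrightarrow>
           typeII_edge_cover G C (insert e M) \<and> card (insert e M) = n + 1)) \<and>
     (\<forall>L. typeII_edge_cover G C L \<and> (\<forall>M. maximum_matching C M \<longrightarrow> \<not> M \<subseteq> L) \<longrightarrow>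
        card L > n + 1) \<and>
     ((\<exists>e \<in> edges G - edges C. \<exists>v \<in> verts C. v \<in> e) \<longrightarrow>
        (\<exists>M v e. maximum_matching C M \<and> v \<in> verts C \<and> \<not> saturated M v \<and>
           e \<in> edges G - edges C \<and> v \<in> e \<and>
           typeII_edge_cover G C (insert e M) \<and> card (insert e M) = n + 1) \<and>
        typeII_edge_cover_number G C = n + 1 \<and>
        (\<forall>L. typeII_minimum_edge_cover G C L \<longrightarrow>
           (\<exists>M v e. maximum_matching C M \<and> v \<in> verts C \<and> \<not> saturated M v \<and>
              e \<in> edges G - edges C \<and> v \<in> e \<and> L = insert e M)))"
proof -
  have verts: "verts C = set xs"
    using assms(5) by (simp add: cycle_graph_def)
  have cV: "card (verts C) = 2 * n + 1"
    using assms(3,4) verts distinct_card by metis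
  have C: "finite_simple_graph C"
    using assms(1,6) by (rule induced_subgraph_simple)
  have near_perfect: "\<exists>M. matching C M \<and> card M = n \<and> \<not> saturated M v" if "v \<in> verts C" for v
    using odd_cycle_near_perfect_matching[OF assms(3,4)] that verts assms(5) by metis
  have "verts C \<noteq> {}"
    using cV by auto
  then obtain M0 where "matching C M0" "card M0 = n"
    using near_perfect by blast
  note max = maximum_matching_iff_odd[OF C cV this]
  note extend = typeII_edge_cover_insert_matching[OF assms(1,6) cV]
  \<comment> \<open>This is the common source of the lower bound, of the claim about covers without
    a maximum matching, and of the description of minimum covers.\<close>
  have shape: "\<exists>M v e. maximum_matching C M \<and> v \<in> verts C \<and> \<not> saturated M v \<and>
      e \<in> edges G - edges C \<and> v \<in> e \<and> L = insert e M \<and> card L = n + 1"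
    if "typeII_edge_cover G C L" "card L \<le> n + 1" for L
    using small_typeII_edge_coverE[OF assms(1,6) cV that] max by metis
  have lower: "n + 1 \<le> card L" if "typeII_edge_cover G C L" for L
    using shape[OF that] by (cases "card L \<le> n + 1") auto
  have part1: "card M = n \<and> card {v \<in> verts C. saturated M v} = 2 * n \<and>
      (\<exists>!v. v \<in> verts C \<and> \<not> saturated M v) \<and>
      (\<forall>v e. v \<in> verts C \<and> \<not> saturated M v \<and> e \<in> edges G - edges C \<and> v \<in> e \<longrightarrow>
         typeII_edge_cover G C (insert e M) \<and> card (insert e M) = n + 1)"
    if "maximum_matching C M" for M
  proof -
    have M: "matching C M" "card M = n"
      using that max by auto
    then show ?thesis
      using card_saturated_matching[OF C M(1)] ex1_unsaturated[OF C cV M] extend[OF M]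
      by (intro conjI allI impI; (elim conjE)?) simp_all
  qed
  have part2: "card L > n + 1"
    if "typeII_edge_cover G C L" "\<forall>M. maximum_matching C M \<longrightarrow> \<not> M \<subseteq> L" for L
  proof (rule ccontr)
    assume "\<not> card L > n + 1"
    then show False
      using shape[OF that(1)] that(2) by auto
  qed
  have part3: "(\<exists>M v e. maximum_matching C M \<and> v \<in> verts C \<and> \<not> saturated M v \<and>
           e \<in> edges G - edges C \<and> v \<in> e \<and>
           typeII_edge_cover G C (insert e M) \<and> card (insert e M) = n + 1) \<and>
        typeII_edge_cover_number G C = n + 1 \<and>
        (\<forall>L. typeII_minimum_edge_cover G C L \<longrightarrow>
           (\<exists>M v e. maximum_matching C M \<and> v \<in> verts C \<and> \<not> saturated M v \<and>
              e \<in> edges G - edges C \<and> v \<in> e \<and> L = insert e M))"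
    if out: "\<exists>e \<in> edges G - edges C. \<exists>v \<in> verts C. v \<in> e"
  proof -
    obtain e v where ev: "e \<in> edges G - edges C" "v \<in> verts C" "v \<in> e"
      using out by blast
    \<comment> \<open>The matching is chosen to miss exactly the vertex at which the outer edge is
      attached.\<close>
    obtain M where M: "matching C M" "card M = n" "\<not> saturated M v"
      using near_perfect[OF ev(2)] by blast
    note cov = extend[OF M(1,2) ev(2) M(3) ev(1,3)]
    have "finite (insert e M)"
      using cov(2) by (intro card_ge_0_finite) linarith
    \<comment> \<open>A proper subset has fewer than n + 1 edges, which \<open>lower\<close>
      forbids; so minimality under inclusion comes from the size alone.\<close>
    then have "\<not> typeII_edge_cover G C L" if "L \<subset> insert e M" for L
      using psubset_card_mono[OF _ that] lower[of L] cov(2) by linarith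
    then have minimal: "typeII_minimal_edge_cover G C (insert e M)"
      using cov(1) by (simp add: typeII_minimal_edge_cover_def)
    have "typeII_edge_cover_number G C = n + 1"
      unfolding typeII_edge_cover_number_def
    proof (rule Least_equality)
      show "\<exists>L. typeII_minimal_edge_cover G C L \<and> card L = n + 1"
        using minimal cov(2) by blast
    qed (auto simp: typeII_minimal_edge_cover_def dest: lower)
    moreover have "\<exists>M v e. maximum_matching C M \<and> v \<in> verts C \<and> \<not> saturated M v \<and>
        e \<in> edges G - edges C \<and> v \<in> e \<and> L = insert e M"
      if "typeII_minimum_edge_cover G C L" for L
    proof -
      have "typeII_edge_cover G C L"
        using that by (simp add: typeII_minimum_edge_cover_def typeII_minimal_edge_cover_def)
      \<comment> \<open>The minimal cover \<open>insert e M\<close> serves as the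
        competitor.\<close>
      moreover have "card L \<le> n + 1"
        using that minimal cov(2) unfolding typeII_minimum_edge_cover_def by metis
      ultimately show ?thesis
        using shape by blast
    qed
    moreover have "maximum_matching C M"
      using max M by blast
    ultimately show ?thesis
      using cov M ev by blast
  qed
  show ?thesis
    by (rule conjI[OF _ conjI]; intro allI impI)
      (erule part1, erule conjE, erule (1) part2, erule part3)
qed

end
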